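(* Let $T\in\mathbb{F}^{n_1}\otimes\mathbb{F}^{n_2}\otimes\mathbb{F}^{n_3}$ be concise and let $i,j,k\in[3]$ be distinct. Suppose $|\mathbb{F}|>n_k$. Then $Q_i(T)\,Q_j(T)\geq n_k$.
   Context: For $T=\sum_{a,b,c}T_{a,b,c}e_a\otimes e_b\otimes e_c$, the 1-slices are $T^{(1)}_a=\sum_{b,c}T_{a,b,c}e_b\otimes e_c$ ($a\in[n_1]$), the 2-slices $T^{(2)}_b=\sum_{a,c}T_{a,b,c}e_a\otimes e_c$, and the 3-slices $T^{(3)}_c=\sum_{a,b}T_{a,b,c}e_a\otimes e_b$, viewed as matrices. For $\ell\in[3]$, $Q_\ell(T)$ is the maximum matrix rank of an element of the linear span of the $\ell$-slices of $T$. $T$ is concise if each flattening $T_i\in\mathbb{F}^{n_i}\otimes(\mathbb{F}^{n_j}\otimes\mathbb{F}^{n_k})$ (an $n_i\times n_jn_k$ matrix) has rank $n_i$. *)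

theory Defs
  imports "Jordan_Normal_Form.DL_Rank"
begin

text \<open>
  A tensor in \<open>F^(n 1) \<otimes> F^(n 2) \<otimes> F^(n 3)\<close> is given by its three dimensions \<open>n 1\<close>, \<open>n 2\<close>, \<open>n 3\<close>
  and its coordinates \<open>T a b c\<close>, with indices counted from 0, so \<open>a < n 1\<close>, \<open>b < n 2\<close>, \<open>c < n 3\<close>.
  Coordinates outside this range, and values \<open>n l\<close> for \<open>l \<notin> {1, 2, 3}\<close>, are never looked at for
  modes in \<open>{1, 2, 3}\<close>.
\<close>

type_synonym 'a tensor3 = "nat \<Rightarrow> nat \<Rightarrow> nat \<Rightarrow> 'a"

text \<open>The coordinate with index \<open>a\<close> in mode \<open>l\<close>, and indices \<open>x\<close>, \<open>y\<close> in the two remaining modes,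
  these taken in increasing order.\<close>

definition coord :: "'a tensor3 \<Rightarrow> nat \<Rightarrow> nat \<Rightarrow> nat \<Rightarrow> nat \<Rightarrow> 'a" where
  "coord T l a x y = (if l = 1 then T a x y else if l = 2 then T x a y else T x y a)"

definition slice_rows :: "(nat \<Rightarrow> nat) \<Rightarrow> nat \<Rightarrow> nat" where
  "slice_rows n l = (if l = 1 then n 2 else n 1)"

definition slice_cols :: "(nat \<Rightarrow> nat) \<Rightarrow> nat \<Rightarrow> nat" where
  "slice_cols n l = (if l = 3 then n 2 else n 3)"

definition slice :: "(nat \<Rightarrow> nat) \<Rightarrow> 'a tensor3 \<Rightarrow> nat \<Rightarrow> nat \<Rightarrow> 'a mat" where
  "slice n T l a = mat (slice_rows n l) (slice_cols n l) (\<lambda>(x, y). coord T l a x y)"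

definition slice_span :: "(nat \<Rightarrow> nat) \<Rightarrow> 'a :: field tensor3 \<Rightarrow> nat \<Rightarrow> 'a mat set" where
  "slice_span n T l =
     LinearCombinations.module.span class_ring
       (module_mat TYPE('a) (slice_rows n l) (slice_cols n l)) (slice n T l ` {..<n l})"

definition Q :: "(nat \<Rightarrow> nat) \<Rightarrow> 'a :: field tensor3 \<Rightarrow> nat \<Rightarrow> nat" where
  "Q n T l = Max (vec_space.rank (slice_rows n l) ` slice_span n T l)"

text \<open>The column of the flattening belonging to the basis vector \<open>e_x \<otimes> e_y\<close> of the two remaining
  modes is number \<open>x * slice_cols n l + y\<close>.\<close>

definition flattening :: "(nat \<Rightarrow> nat) \<Rightarrow> 'a tensor3 \<Rightarrow> nat \<Rightarrow> 'a mat" where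
  "flattening n T l = mat (n l) (slice_rows n l * slice_cols n l)
     (\<lambda>(a, p). coord T l a (p div slice_cols n l) (p mod slice_cols n l))"

definition concise :: "(nat \<Rightarrow> nat) \<Rightarrow> 'a :: field tensor3 \<Rightarrow> bool" where
  "concise n T \<longleftrightarrow> (\<forall>l\<in>{1, 2, 3}. vec_space.rank (n l) (flattening n T l) = n l)"

text \<open>The maximum in the definition of \<open>Q\<close> is over a finite nonempty set.\<close>

lemma slice_span_carrier:
  "slice_span n T l \<subseteq> carrier_mat (slice_rows n l) (slice_cols n l)"
proof -
  interpret M: matrix_vs "slice_rows n l" "slice_cols n l" "TYPE('a)" .
  have "slice n T l ` {..<n l} \<subseteq> carrier_mat (slice_rows n l) (slice_cols n l)"
    by (auto simp: slice_def)
  then show ?thesis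
    unfolding slice_span_def by (rule M.span_is_subset2)
qed

lemma finite_slice_span_ranks: "finite (vec_space.rank (slice_rows n l) ` slice_span n T l)"
proof (rule finite_subset)
  show "vec_space.rank (slice_rows n l) ` slice_span n T l \<subseteq> {..slice_cols n l}"
    using slice_span_carrier vec_space.rank_le_nc by blast
qed simp

lemma slice_span_nonempty: "slice_span n T l \<noteq> {}"
proof -
  interpret M: matrix_vs "slice_rows n l" "slice_cols n l" "TYPE('a)" .
  show ?thesis
    unfolding slice_span_def M.span_def by auto
qed

end

theory Submission
  imports Defs "Jordan_Normal_Form.Char_Poly"
begin

text \<open>
  Let \<open>A\<close> be an element of the span of the \<open>i\<close>-slices of maximal rank \<open>r\<close>, a matrix of size
  \<open>n j \<times> n k\<close>, and choose \<open>U\<close>, \<open>V\<close> with \<open>U A V = 1\<close> of size \<open>r\<close>.  For every \<open>B\<close> in the span, no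
  \<open>B + t A\<close> has rank above \<open>r\<close>; since the field has more than \<open>r\<close> elements, comparing leading
  coefficients in \<open>t\<close> of bordered determinants gives \<open>(1 - A V U) B (1 - V U A) = 0\<close>.  So a vector
  \<open>v\<close> with \<open>U B v = 0\<close> for all \<open>B\<close> in the span satisfies \<open>B v = 0\<close> for all \<open>B\<close>, and \<open>v = 0\<close> by
  conciseness.  The condition \<open>U B v = 0\<close> for all \<open>B\<close> says that \<open>C v = 0\<close> for the \<open>r\<close> combinations \<open>C\<close>
  of \<open>j\<close>-slices whose coefficients are the rows of \<open>U\<close>.  Each \<open>C\<close> imposes at most \<open>Q j\<close> linear
  conditions on \<open>v\<close>, hence \<open>n k \<le> r * Q j\<close>.
\<close>

section \<open>Rank, factorizations and minors\<close>

text \<open>Padding \<open>G\<close> with zero rows gives a singular square matrix \<open>H\<close>,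
  and a kernel vector of \<open>H\<close> is one of \<open>G\<close>.\<close>

lemma wide_mat_kernel:
  fixes G :: "'a :: field mat"
  assumes G: "G \<in> carrier_mat m n" and mn: "m < n"
  obtains v where "v \<in> carrier_vec n" "v \<noteq> 0\<^sub>v n" "G *\<^sub>v v = 0\<^sub>v m"
proof -
  define H where "H = mat n n (\<lambda>(i, j). if i < m then G $$ (i, j) else 0)"
  have H: "H \<in> carrier_mat n n" by (simp add: H_def)
  \<comment> \<open>As \<open>m < n\<close>, row \<open>n - 1\<close> of \<open>H\<close> is one of
    the added zero rows, so the transpose kills the last unit vector.\<close>
  have "H\<^sup>T *\<^sub>v unit_vec n (n - 1) = 0\<^sub>v n"
    using mn by (intro eq_vecI) (auto simp: H_def)
  moreover have "unit_vec n (n - 1) \<noteq> (0\<^sub>v n :: 'a vec)"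
    using mn by simp
  ultimately have "det (H\<^sup>T) = 0"
    using det_0_iff_vec_prod_zero_field[of "H\<^sup>T" n] H unit_vec_carrier[of n "n - 1"]
    by (metis transpose_carrier_mat)
  then have "det H = 0" using det_transpose[OF H] by simp
  then obtain v where v: "v \<in> carrier_vec n" "v \<noteq> 0\<^sub>v n" "H *\<^sub>v v = 0\<^sub>v n"
    using det_0_iff_vec_prod_zero_field[OF H] by auto
  have "(G *\<^sub>v v) $ i = 0" if "i < m" for i
  proof -
    have "row H i = row G i" using that mn G by (intro eq_vecI) (auto simp: H_def)
    moreover have "(H *\<^sub>v v) $ i = 0" using v(3) that mn by simp
    ultimately show ?thesis using that mn G H by simp
  qed
  then have "G *\<^sub>v v = 0\<^sub>v m" using G by (intro eq_vecI) auto
  with v show thesis using that by blast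
qed

text \<open>A maximal independent set of columns spans all columns, since a column outside its span
  could be added. The basis is a distinct list so that it can be assembled into a matrix.\<close>

lemma (in vec_space) column_basis:
  assumes A: "A \<in> carrier_mat n nc"
  obtains ls where "set ls \<subseteq> set (cols A)" "distinct ls" "lin_indpt (set ls)"
    "rank A = length ls" "set (cols A) \<subseteq> span (set ls)"
proof -
  obtain S where S: "maximal S (\<lambda>T. T \<subseteq> set (cols A) \<and> lin_indpt T)"
    using maximal_exists_superset[of "set (cols A)" "\<lambda>T. T \<subseteq> set (cols A) \<and> lin_indpt T" "{}"]
    by (auto simp: lin_dep_def)
  then have sub: "S \<subseteq> set (cols A)" and ind: "lin_indpt S" by (auto simp: maximal_def)
  have "finite S" using sub finite_subset by blast
  then obtain ls where ls: "set ls = S" "distinct ls" using finite_distinct_list by blast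
  have card: "rank A = length ls"
    using rank_card_indpt[OF A S] ls distinct_card by metis
  have colsA: "set (cols A) \<subseteq> carrier_vec n" using A cols_dim[of A] carrier_matD(1)[OF A] by force
  have S_carrier: "S \<subseteq> carrier_vec n" using sub colsA by blast
  have "set (cols A) \<subseteq> span S"
  proof (rule ccontr)
    assume "\<not> set (cols A) \<subseteq> span S"
    then obtain c where c: "c \<in> set (cols A)" "c \<notin> span S" by blast
    then have "c \<notin> S" using S_carrier span_mem by blast
    moreover have "lin_indpt (S \<union> {c})"
      using lin_dep_iff_in_span[of S c] c colsA ind S_carrier calculation by blast
    ultimately show False using S sub c unfolding maximal_def by blast
  qed
  with sub ind ls card show thesis using that by metis
qed

text \<open>More than \<open>m\<close> independent columns of \<open>L * R\<close> would come from
  more than \<open>m\<close> columns of \<open>R\<close>, which have length \<open>m\<close> and so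
  satisfy a nontrivial relation; \<open>L\<close> carries that relation over.\<close>

lemma rank_le_if_factor:
  fixes L R :: "'a :: field mat"
  assumes L: "L \<in> carrier_mat p m" and R: "R \<in> carrier_mat m q"
  shows "vec_space.rank p (L * R) \<le> m"
proof (rule ccontr)
  interpret vec_space "TYPE('a)" p .
  let ?A = "L * R"
  have A: "?A \<in> carrier_mat p q" using L R by simp
  assume less: "\<not> rank ?A \<le> m"
  obtain ls where sub: "set ls \<subseteq> set (cols ?A)" and dist: "distinct ls"
    and ind: "lin_indpt (set ls)" and card: "rank ?A = length ls"
    using column_basis[OF A] by metis
  have "\<forall>x\<in>set ls. \<exists>j. j < q \<and> x = col ?A j"
    using sub A unfolding cols_def by fastforce
  then obtain f where f: "\<And>x. x \<in> set ls \<Longrightarrow> f x < q \<and> x = col ?A (f x)" by metis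
  \<comment> \<open>Choosing the columns of \<open>R\<close> at the positions of the basis columns
    of \<open>L * R\<close> makes \<open>L * X\<close> the matrix of that basis.\<close>
  define X where "X = mat_of_cols m (map (\<lambda>x. col R (f x)) ls)"
  have X: "X \<in> carrier_mat m (length ls)"
    unfolding X_def using mat_of_cols_carrier(1)[of m "map (\<lambda>x. col R (f x)) ls"] by simp
  have lsp: "mat_of_cols p ls \<in> carrier_mat p (length ls)" by simp
  have LX: "mat_of_cols p ls = L * X"
  proof (rule eq_matI)
    fix i j assume "i < dim_row (L * X)" "j < dim_col (L * X)"
    then have i: "i < p" and j: "j < length ls" using L X by auto
    have fj: "f (ls ! j) < q" "ls ! j = col ?A (f (ls ! j))" using f[of "ls ! j"] j by auto
    have cX: "col X j = col R (f (ls ! j))"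
      using j R unfolding X_def by (subst col_mat_of_cols) auto
    have "mat_of_cols p ls $$ (i, j) = (ls ! j) $ i"
      using i j by (simp add: mat_of_cols_index)
    also have "\<dots> = ?A $$ (i, f (ls ! j))"
      using fj i A L R by (metis carrier_matD(1) carrier_matD(2) index_col)
    also have "\<dots> = (L * X) $$ (i, j)" using fj(1) i j L R X cX by simp
    finally show "mat_of_cols p ls $$ (i, j) = (L * X) $$ (i, j)" .
  qed (use L X in auto)
  have "m < length ls" using less card by simp
  then obtain v where v: "v \<in> carrier_vec (length ls)" "v \<noteq> 0\<^sub>v (length ls)" "X *\<^sub>v v = 0\<^sub>v m"
    using wide_mat_kernel[OF X] by blast
  have "mat_of_cols p ls *\<^sub>v v = L *\<^sub>v (X *\<^sub>v v)"
    unfolding LX using L X v(1) by simp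
  also have "\<dots> = 0\<^sub>v p" unfolding v(3) using L by (intro eq_vecI) (auto simp: scalar_prod_def)
  finally have z: "mat_of_cols p ls *\<^sub>v v = 0\<^sub>v p" .
  have "set ls \<subseteq> carrier_vec p" using sub cols_dim[of ?A] carrier_matD(1)[OF A] by force
  then have c: "cols (mat_of_cols p ls) = ls" by (rule cols_mat_of_cols)
  have "lin_dep (set ls)" using lin_depI[OF lsp v(1,2) z] c dist by simp
  with ind show False by simp
qed

text \<open>\<open>L\<close> consists of a column basis of \<open>A\<close>, and \<open>R\<close> of
  the coordinates of the columns of \<open>A\<close> in it.\<close>

lemma factor_of_rank:
  fixes A :: "'a :: field mat"
  assumes A: "A \<in> carrier_mat p q"
  obtains L R where "L \<in> carrier_mat p (vec_space.rank p A)"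
    "R \<in> carrier_mat (vec_space.rank p A) q" "A = L * R"
proof -
  interpret vec_space "TYPE('a)" p .
  obtain ls where sub: "set ls \<subseteq> set (cols A)" and card: "rank A = length ls"
    and gen: "set (cols A) \<subseteq> span (set ls)"
    using column_basis[OF A] by metis
  have lsc: "set ls \<subseteq> carrier_vec p"
    using sub cols_dim[of A] unfolding carrier_matD(1)[OF A] by (rule subset_trans)
  let ?L = "mat_of_cols p ls"
  have L: "?L \<in> carrier_mat p (length ls)" by simp
  have c: "cols ?L = ls" using lsc by (rule cols_mat_of_cols)
  have "\<exists>x. x \<in> carrier_vec (length ls) \<and> ?L *\<^sub>v x = col A j" if j: "j < q" for j
  proof -
    have "col A j \<in> set (cols A)" using j A by (auto simp: cols_def)
    then have "col A j \<in> span (set ls)" using gen by blast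
    then have "col A j \<in> col_space ?L" unfolding col_space_def c .
    then show ?thesis unfolding col_space_eq[OF L] by auto
  qed
  then obtain f where f: "\<And>j. j < q \<Longrightarrow> f j \<in> carrier_vec (length ls) \<and> ?L *\<^sub>v f j = col A j"
    by metis
  define R where "R = mat (length ls) q (\<lambda>(i, j). f j $ i)"
  have R: "R \<in> carrier_mat (length ls) q" by (simp add: R_def)
  have "A = ?L * R"
  proof (rule eq_matI)
    fix i j assume "i < dim_row (?L * R)" "j < dim_col (?L * R)"
    then have i: "i < p" and j: "j < q" using R by auto
    have "col R j = f j" using f[OF j] j by (intro eq_vecI) (auto simp: R_def)
    then have "(?L * R) $$ (i, j) = (?L *\<^sub>v f j) $ i" using i j R by simp
    then show "A $$ (i, j) = (?L * R) $$ (i, j)" using f[OF j] i j A by simp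
  qed (use A R in auto)
  with L R card show thesis using that by metis
qed

text \<open>Zero columns of \<open>L'\<close> and zero rows of \<open>R'\<close> fill up the inner
  dimension, so that matrices of different ranks can be factored through one common
  \<open>m\<close>.\<close>

lemma factor_of_rank_le:
  fixes A :: "'a :: field mat"
  assumes A: "A \<in> carrier_mat p q" and le: "vec_space.rank p A \<le> m"
  obtains L R where "L \<in> carrier_mat p m" "R \<in> carrier_mat m q" "A = L * R"
proof -
  let ?r = "vec_space.rank p A"
  obtain L R where L: "L \<in> carrier_mat p ?r" and R: "R \<in> carrier_mat ?r q" and eq: "A = L * R"
    using factor_of_rank[OF A] .
  define L' where "L' = mat p m (\<lambda>(i, j). if j < ?r then L $$ (i, j) else 0)"
  define R' where "R' = mat m q (\<lambda>(i, j). if i < ?r then R $$ (i, j) else 0)"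
  have "A = L' * R'"
  proof (rule eq_matI)
    fix i j assume "i < dim_row (L' * R')" "j < dim_col (L' * R')"
    then have i: "i < p" and j: "j < q" by (auto simp: L'_def R'_def)
    have "(L' * R') $$ (i, j) = (\<Sum>k<m. if k < ?r then L $$ (i, k) * R $$ (k, j) else 0)"
      using i j by (auto simp: L'_def R'_def scalar_prod_def lessThan_atLeast0 intro!: sum.cong)
    also have "\<dots> = (\<Sum>k<?r. L $$ (i, k) * R $$ (k, j))"
      using le by (intro sum.mono_neutral_cong_right) auto
    also have "\<dots> = A $$ (i, j)"
      using i j L R by (subst eq) (auto simp: scalar_prod_def lessThan_atLeast0)
    finally show "A $$ (i, j) = (L' * R') $$ (i, j)" by simp
  qed (use A in \<open>auto simp: L'_def R'_def\<close>)
  moreover have "L' \<in> carrier_mat p m" "R' \<in> carrier_mat m q" by (simp_all add: L'_def R'_def)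
  ultimately show thesis using that by blast
qed

text \<open>If the rank were below \<open>m\<close>, then \<open>U * A * V\<close> would factor
  through a space of smaller dimension and have a nonzero kernel vector.\<close>

lemma rank_ge_if_det:
  fixes A :: "'a :: field mat"
  assumes A: "A \<in> carrier_mat p q" and U: "U \<in> carrier_mat m p" and V: "V \<in> carrier_mat q m"
    and det: "det (U * A * V) \<noteq> 0"
  shows "m \<le> vec_space.rank p A"
proof (rule ccontr)
  let ?r = "vec_space.rank p A"
  assume "\<not> m \<le> ?r"
  then have less: "?r < m" by simp
  obtain L R where L: "L \<in> carrier_mat p ?r" and R: "R \<in> carrier_mat ?r q" and eq: "A = L * R"
    using factor_of_rank[OF A] .
  have RV: "R * V \<in> carrier_mat ?r m" using R V by simp
  obtain v where v: "v \<in> carrier_vec m" "v \<noteq> 0\<^sub>v m" "(R * V) *\<^sub>v v = 0\<^sub>v ?r"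
    using wide_mat_kernel[OF RV less] .
  have "U * A * V = (U * L) * (R * V)"
    using U V L R A unfolding eq
    by (smt (verit) assoc_mult_mat mult_carrier_mat)
  then have "(U * A * V) *\<^sub>v v = (U * L) *\<^sub>v ((R * V) *\<^sub>v v)"
    using U L RV v(1) by (metis assoc_mult_mat_vec mult_carrier_mat)
  also have "\<dots> = 0\<^sub>v m"
    unfolding v(3) using U L by (intro eq_vecI) (auto simp: scalar_prod_def)
  finally have "(U * A * V) *\<^sub>v v = 0\<^sub>v m" .
  moreover have "U * A * V \<in> carrier_mat m m" using U A V by simp
  ultimately show False using det det_0_iff_vec_prod_zero_field v by blast
qed

section \<open>Bordered determinants, and the rank as the largest size of a nonzero minor\<close>

lemma triple_product_entry:
  assumes X: "X \<in> carrier_mat a p" and M: "M \<in> carrier_mat p q" and Y: "Y \<in> carrier_mat q b"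
    and i: "i < a" and j: "j < b"
  shows "(X * M * Y) $$ (i, j) = row X i \<bullet> (M *\<^sub>v col Y j)"
proof -
  have "(X * M * Y) $$ (i, j) = (X * (M * Y)) $$ (i, j)"
    by (simp only: assoc_mult_mat[OF X M Y])
  also have "\<dots> = row X i \<bullet> col (M * Y) j"
    using X M Y i j by (intro index_mult_mat(1)) auto
  also have "col (M * Y) j = M *\<^sub>v col Y j" by (rule col_mult2[OF M Y j])
  finally show ?thesis .
qed

text \<open>Bordering \<open>U\<close> with the \<open>k\<close>-th row of \<open>E\<close> and \<open>V\<close> with the \<open>l\<close>-th column of \<open>P\<close> extends the
  \<open>m\<times>m\<close> matrix \<open>U M V\<close> by entries of \<open>E M V\<close>, \<open>U M P\<close> and \<open>E M P\<close>.\<close>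

lemma bordered_entry:
  fixes M :: "'a :: comm_ring_1 mat"
  assumes M: "M \<in> carrier_mat p q"
    and U: "U \<in> carrier_mat m p" and E: "E \<in> carrier_mat a p" and k: "k < a"
    and V: "V \<in> carrier_mat q m" and P: "P \<in> carrier_mat q b" and l: "l < b"
    and i: "i < Suc m" and j: "j < Suc m"
  shows "(mat (Suc m) p (\<lambda>(i, j). if i < m then U $$ (i, j) else E $$ (k, j)) * M *
      mat q (Suc m) (\<lambda>(i, j). if j < m then V $$ (i, j) else P $$ (i, l))) $$ (i, j) =
    ((if i < m then U else E) * M * (if j < m then V else P)) $$
      (if i < m then i else k, if j < m then j else l)"
    (is "(?W * M * ?Z) $$ _ = (?X * M * ?Y) $$ (?i, ?j)")
proof -
  have X: "?X \<in> carrier_mat (if i < m then m else a) p"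
    and Y: "?Y \<in> carrier_mat q (if j < m then m else b)"
    using U E V P by auto
  have "row ?W i = row ?X ?i"
    using i k U E by (intro eq_vecI) auto
  moreover have "col ?Z j = col ?Y ?j"
    using j l V P by (intro eq_vecI) auto
  moreover have "(?W * M * ?Z) $$ (i, j) = row ?W i \<bullet> (M *\<^sub>v col ?Z j)"
    by (rule triple_product_entry[OF _ M _ i j]) simp_all
  moreover have "(?X * M * ?Y) $$ (?i, ?j) = row ?X ?i \<bullet> (M *\<^sub>v col ?Y ?j)"
    by (rule triple_product_entry[OF X M Y]) (use k l in simp_all)
  ultimately show ?thesis by (simp only:)
qed

text \<open>The first \<open>m\<close> rows are those of the identity, so \<open>D\<close> is lower
  triangular with diagonal \<open>1, ..., 1, D $$ (m, m)\<close>.\<close>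

lemma det_corner:
  fixes D :: "'a :: comm_ring_1 mat"
  assumes D: "D \<in> carrier_mat (Suc m) (Suc m)"
    and one: "\<And>i j. i < m \<Longrightarrow> j < Suc m \<Longrightarrow> D $$ (i, j) = (if i = j then 1 else 0)"
  shows "det D = D $$ (m, m)"
proof -
  have "det D = prod_list (diag_mat D)"
    using one by (intro det_lower_triangular[OF _ D]) auto
  also have "\<dots> = (\<Prod>i = 0..<Suc m. D $$ (i, i))"
    using D by (simp add: prod_list_diag_prod)
  also have "\<dots> = D $$ (m, m)" using one by (simp add: prod.atLeast0_lessThan_Suc)
  finally show ?thesis .
qed

text \<open>The difference of the two sides is \<open>E * A\<close> with
  \<open>E = 1 - A V U\<close>. Each of its entries is the determinant of a bordering of
  \<open>U * A * V\<close> by one row and one column, which \<open>max\<close> makes zero.\<close>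

lemma skeleton_decomposition:
  fixes A :: "'a :: field mat"
  assumes A: "A \<in> carrier_mat p q" and U: "U \<in> carrier_mat m p" and V: "V \<in> carrier_mat q m"
    and one: "U * A * V = 1\<^sub>m m"
    and max: "\<And>W Z. W \<in> carrier_mat (Suc m) p \<Longrightarrow> Z \<in> carrier_mat q (Suc m) \<Longrightarrow> det (W * A * Z) = 0"
  shows "A = A * V * (U * A)"
proof -
  define E where "E = 1\<^sub>m p - A * V * U"
  have AV: "A * V \<in> carrier_mat p m" and UA: "U * A \<in> carrier_mat m q" and AVU: "A * V * U \<in> carrier_mat p p"
    using A U V mult_carrier_mat by blast+
  have E: "E \<in> carrier_mat p p" unfolding E_def using AVU by (rule minus_carrier_mat)
  have EA: "E * A = A - A * V * (U * A)"
    unfolding E_def using A AV U AVU by (simp add: minus_mult_distrib_mat[of _ p p] assoc_mult_mat[OF AV U A])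
  have "A * V * (U * A) * V = A * V * (U * A * V)"
    using AV UA V by simp
  then have EAV: "E * A * V = 0\<^sub>m p m"
    unfolding EA one using A AV UA V by (subst minus_mult_distrib_mat[of _ p q]) (auto simp: one)
  define P where "P = 1\<^sub>m q - V * (U * A)"
  have VUA: "V * (U * A) \<in> carrier_mat q q" using V UA by (rule mult_carrier_mat)
  have P: "P \<in> carrier_mat q q" unfolding P_def using VUA by (rule minus_carrier_mat)
  have "U * A * P = U * A - U * A * (V * (U * A))"
    unfolding P_def using UA VUA by (subst mult_minus_distrib_mat[of _ m q]) auto
  also have "U * A * (V * (U * A)) = U * A"
    by (metis assoc_mult_mat[OF UA V UA] one left_mult_one_mat[OF UA])
  finally have UAP: "U * A * P = 0\<^sub>m m q" using UA by simp
  have "(E * A) $$ (k, l) = 0" if k: "k < p" and l: "l < q" for k l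
  proof -
    have "E * A * P = E * A - E * A * (V * (U * A))"
      unfolding P_def using E A VUA by (subst mult_minus_distrib_mat[of _ p q]) auto
    also have "E * A * (V * (U * A)) = 0\<^sub>m p q"
      by (metis assoc_mult_mat[OF mult_carrier_mat[OF E A] V UA] EAV left_mult_zero_mat[OF UA])
    finally have EAP: "E * A * P = E * A" using E A by (intro eq_matI) auto
    \<comment> \<open>\<open>E A V = 0\<close> and \<open>U A P = 0\<close>, so bordering gives a block diagonal matrix with corner \<open>E A P\<close>\<close>
    let ?W = "mat (Suc m) p (\<lambda>(i, j). if i < m then U $$ (i, j) else E $$ (k, j))"
    let ?Z = "mat q (Suc m) (\<lambda>(i, j). if j < m then V $$ (i, j) else P $$ (i, l))"
    have "det (?W * A * ?Z) = (?W * A * ?Z) $$ (m, m)"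
    proof (rule det_corner)
      fix i j assume ij: "i < m" "j < Suc m"
      then show "(?W * A * ?Z) $$ (i, j) = (if i = j then 1 else 0)"
        unfolding bordered_entry[OF A U E k V P l less_SucI[OF ij(1)] ij(2)]
        by (cases "j < m") (simp_all only: one UAP if_True if_False index_one_mat index_zero_mat k l, simp)
    qed auto
    also have "\<dots> = (E * A * P) $$ (k, l)"
      using bordered_entry[OF A U E k V P l, of m m] by simp
    also have "\<dots> = (E * A) $$ (k, l)" by (simp only: EAP)
    finally show ?thesis using max[of ?W ?Z] by simp
  qed
  then have "E * A = 0\<^sub>m p q" using E A by (intro eq_matI) auto
  then have diff: "A - A * V * (U * A) = 0\<^sub>m p q" unfolding EA .
  have B: "A * V * (U * A) \<in> carrier_mat p q" using AV UA by (rule mult_carrier_mat)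
  show ?thesis
  proof (rule eq_matI)
    fix i j assume "i < dim_row (A * V * (U * A))" "j < dim_col (A * V * (U * A))"
    then have ij: "i < p" "j < q" using B by auto
    have "A $$ (i, j) - (A * V * (U * A)) $$ (i, j) = (A - A * V * (U * A)) $$ (i, j)"
      using ij B by (subst index_minus_mat) auto
    then show "A $$ (i, j) = (A * V * (U * A)) $$ (i, j)" unfolding diff using ij by simp
  qed (use A B in auto)
qed

text \<open>Let \<open>m\<close> be the largest size for which some \<open>U * A * V\<close> is
  invertible. By maximality the skeleton decomposition factors \<open>A\<close> through dimension
  \<open>m\<close>, so \<open>m\<close> is also an upper bound for the rank.\<close>

lemma rank_attained:
  fixes A :: "'a :: field mat"
  assumes A: "A \<in> carrier_mat p q"
  obtains U V where "U \<in> carrier_mat (vec_space.rank p A) p" "V \<in> carrier_mat q (vec_space.rank p A)"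
    "U * A * V = 1\<^sub>m (vec_space.rank p A)"
proof -
  define S where "S = {m. \<exists>U V. U \<in> carrier_mat m p \<and> V \<in> carrier_mat q m \<and> det (U * A * V) \<noteq> 0}"
  have ge: "m \<le> vec_space.rank p A" if "m \<in> S" for m
    using that rank_ge_if_det[OF A] unfolding S_def by blast
  then have fin: "finite S" by (meson finite_nat_set_iff_bounded_le)
  \<comment> \<open>The determinant of size 0 is 1, so \<open>S\<close> is nonempty and has a
    maximum.\<close>
  have "det (0\<^sub>m 0 p * A * 0\<^sub>m q 0) \<noteq> 0"
    using A by (simp add: det_def)
  then have "0 \<in> S" unfolding S_def using zero_carrier_mat by blast
  define m where "m = Max S"
  have mS: "m \<in> S" and maxS: "\<And>l. l \<in> S \<Longrightarrow> l \<le> m"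
    unfolding m_def using fin \<open>0 \<in> S\<close> Max_in[of S] by (blast, simp)
  from mS obtain U V where U: "U \<in> carrier_mat m p" and V: "V \<in> carrier_mat q m"
    and det: "det (U * A * V) \<noteq> 0" unfolding S_def by blast
  have UAV: "U * A * V \<in> carrier_mat m m" using U A V by simp
  \<comment> \<open>The inverse of \<open>U * A * V\<close> is absorbed into \<open>U\<close>, which
    turns the product into the identity.\<close>
  obtain D where D: "D \<in> carrier_mat m m" "D * (U * A * V) = 1\<^sub>m m"
    using det_non_zero_imp_unit[OF UAV det] unfolding Units_def by (auto simp: ring_mat_def)
  have U': "D * U \<in> carrier_mat m p" using D U by simp
  have one: "(D * U) * A * V = 1\<^sub>m m"
    using D U A V assoc_mult_mat[of D m m U p A q] assoc_mult_mat[of D m m "U * A" q V m] by simp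
  have "Suc m \<notin> S" using maxS by fastforce
  then have max: "\<And>W Z. W \<in> carrier_mat (Suc m) p \<Longrightarrow> Z \<in> carrier_mat q (Suc m) \<Longrightarrow> det (W * A * Z) = 0"
    unfolding S_def by blast
  have "A = A * V * (D * U * A)" using skeleton_decomposition[OF A U' V one max] .
  then have "vec_space.rank p A \<le> m"
    using rank_le_if_factor[of "A * V" p m "D * U * A" q] A V U' by simp
  then have "vec_space.rank p A = m" using ge[OF mS] by simp
  then show thesis using that U' V one by simp
qed

text \<open>Transposing \<open>U * A * V = 1\<close> gives a nonzero determinant of the same size
  for the transpose of \<open>A\<close>.\<close>

lemma rank_transpose_ge:
  fixes A :: "'a :: field mat"
  assumes A: "A \<in> carrier_mat p q"
  shows "vec_space.rank p A \<le> vec_space.rank q A\<^sup>T"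
proof -
  let ?r = "vec_space.rank p A"
  obtain U V where UV: "U \<in> carrier_mat ?r p" "V \<in> carrier_mat q ?r" "U * A * V = 1\<^sub>m ?r"
    using rank_attained[OF A] .
  have "V\<^sup>T * A\<^sup>T * U\<^sup>T = (U * A * V)\<^sup>T"
    using transpose_mult[OF mult_carrier_mat[OF UV(1) A] UV(2)] transpose_mult[OF UV(1) A] UV(1,2) A
    by (simp add: assoc_mult_mat[of _ ?r q _ p _ ?r])
  then have "det (V\<^sup>T * A\<^sup>T * U\<^sup>T) \<noteq> 0" unfolding UV(3) by simp
  then show ?thesis using rank_ge_if_det[of "A\<^sup>T" q p "V\<^sup>T" ?r "U\<^sup>T"] UV(1,2) A by simp
qed

lemma rank_transpose:
  fixes A :: "'a :: field mat"
  assumes A: "A \<in> carrier_mat p q"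
  shows "vec_space.rank q A\<^sup>T = vec_space.rank p A"
  using rank_transpose_ge[OF A] rank_transpose_ge[of "A\<^sup>T" q p] A by simp

text \<open>Full row rank gives \<open>F\<close> a right inverse \<open>V * U\<close>, whose
  transpose is a left inverse of the transpose of \<open>F\<close>.\<close>

lemma full_row_rank_annihilator:
  fixes F :: "'a :: field mat"
  assumes F: "F \<in> carrier_mat n q" and rank: "vec_space.rank n F = n"
    and v: "v \<in> carrier_vec n" and z: "F\<^sup>T *\<^sub>v v = 0\<^sub>v q"
  shows "v = 0\<^sub>v n"
proof -
  obtain U V where U: "U \<in> carrier_mat n n" and V: "V \<in> carrier_mat q n" and one: "U * F * V = 1\<^sub>m n"
    using rank_attained[OF F] rank by metis
  have "U * (F * V) = 1\<^sub>m n" using one U F V by simp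
  then have "(F * V) * U = 1\<^sub>m n"
    using mat_mult_left_right_inverse[OF U, of "F * V"] F V by simp
  then have "F * (V * U) = 1\<^sub>m n" using F V U by simp
  then have "(V * U)\<^sup>T * F\<^sup>T = 1\<^sub>m n"
    using transpose_mult[OF F, of "V * U" n] U V by simp
  then have "v = (V * U)\<^sup>T *\<^sub>v (F\<^sup>T *\<^sub>v v)"
    using v U V F by (metis assoc_mult_mat_vec mult_carrier_mat one_mult_mat_vec transpose_carrier_mat)
  also have "\<dots> = 0\<^sub>v n" unfolding z using U V by (intro eq_vecI) (auto simp: scalar_prod_def)
  finally show ?thesis .
qed

section \<open>Pencils of bounded rank\<close>

text \<open>The degree is only bounded, as some \<open>c i\<close> may vanish. In the induction this
  bound removes the contribution of \<open>d m\<close> to the top coefficient.\<close>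

lemma coeff_prod_linear:
  fixes d c :: "nat \<Rightarrow> 'a :: comm_ring_1"
  shows "degree (\<Prod>i<m. [:d i, c i:]) \<le> m" and "coeff (\<Prod>i<m. [:d i, c i:]) m = (\<Prod>i<m. c i)"
proof (induction m)
  case (Suc m)
  {
    case 1
    have "degree [:d m, c m:] \<le> 1" by simp
    then have "degree ((\<Prod>i<m. [:d i, c i:]) * [:d m, c m:]) \<le> m + 1"
      using degree_mult_le Suc(1) add_mono order_trans by blast
    then show ?case by (simp only: prod.lessThan_Suc flip: Suc_eq_plus1)
  next
    case 2
    have "coeff (\<Prod>i<m. [:d i, c i:]) (Suc m) = 0"
      using Suc(1) by (intro coeff_eq_0) simp
    then show ?case using Suc(2) by (simp add: mult.commute)
  }
qed simp_all

text \<open>As a polynomial in \<open>t\<close>, the determinant has degree at most \<open>m\<close>, and its coefficient at \<open>t^m\<close> is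
  the corner entry.\<close>

lemma bordered_pencil_corner:
  fixes b :: "nat \<Rightarrow> nat \<Rightarrow> 'a :: field"
  assumes big: "infinite (UNIV :: 'a set) \<or> card (UNIV :: 'a set) > m"
    and zero: "\<And>t. det (mat (Suc m) (Suc m) (\<lambda>(i, j). b i j + t * (if i = j \<and> i < m then 1 else 0))) = 0"
  shows "b m m = 0"
proof -
  define d where "d i j = (if i = j \<and> i < m then 1 else 0 :: 'a)" for i j
  define Z where "Z = mat (Suc m) (Suc m) (\<lambda>(i, j). [:b i j, d i j:])"
  \<comment> \<open>\<open>D\<close> collects the coefficients that produce \<open>t^m\<close>: the
    linear ones in the rows before \<open>m\<close>, the constant ones in row
    \<open>m\<close>.\<close>
  define D where "D = mat (Suc m) (Suc m) (\<lambda>(i, j). if i < m then d i j else b i j)"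
  have Z: "Z \<in> carrier_mat (Suc m) (Suc m)" and D: "D \<in> carrier_mat (Suc m) (Suc m)"
    by (simp_all add: Z_def D_def)
  let ?S = "{\<pi>. \<pi> permutes {0..<Suc m}}"
  \<comment> \<open>Row \<open>m\<close> of \<open>Z\<close> does not involve \<open>t\<close>, so
    every summand of the determinant has only \<open>m\<close> factors that may be linear.\<close>
  have summand: "(\<Prod>i = 0..<Suc m. Z $$ (i, \<pi> i)) = (\<Prod>i<m. [:b i (\<pi> i), d i (\<pi> i):]) * [:b m (\<pi> m):]"
    if "\<pi> \<in> ?S" for \<pi>
  proof -
    have in_range: "\<pi> i < Suc m" if "i < Suc m" for i
      using \<open>\<pi> \<in> ?S\<close> that permutes_in_image[of \<pi> "{0..<Suc m}" i] by auto
    show ?thesis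
      using in_range by (simp add: Z_def d_def lessThan_atLeast0)
  qed
  have detZ: "det Z = (\<Sum>\<pi>\<in>?S. signof \<pi> * ((\<Prod>i<m. [:b i (\<pi> i), d i (\<pi> i):]) * [:b m (\<pi> m):]))"
    unfolding det_def'[OF Z] using summand by (intro sum.cong) simp_all
  have "degree (signof \<pi> * ((\<Prod>i<m. [:b i (\<pi> i), d i (\<pi> i):]) * [:b m (\<pi> m):])) \<le> m" for \<pi>
  proof -
    have "degree ((\<Prod>i<m. [:b i (\<pi> i), d i (\<pi> i):]) * [:b m (\<pi> m):]) \<le> m"
      using degree_mult_le[of "\<Prod>i<m. [:b i (\<pi> i), d i (\<pi> i):]" "[:b m (\<pi> m):]"]
        coeff_prod_linear(1)[of "\<lambda>i. b i (\<pi> i)" "\<lambda>i. d i (\<pi> i)" m] by simp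
    then show ?thesis by (auto simp: sign_def split: if_splits)
  qed
  then have deg: "degree (det Z) \<le> m" unfolding detZ by (intro degree_sum_le) (auto simp: finite_permutations)
  have "coeff (signof \<pi> * ((\<Prod>i<m. [:b i (\<pi> i), d i (\<pi> i):]) * [:b m (\<pi> m):])) m =
      signof \<pi> * (\<Prod>i = 0..<Suc m. D $$ (i, \<pi> i))" if "\<pi> \<in> ?S" for \<pi>
  proof -
    have in_range: "\<pi> i < Suc m" if "i < Suc m" for i
      using \<open>\<pi> \<in> ?S\<close> that permutes_in_image[of \<pi> "{0..<Suc m}" i] by auto
    have "(\<Prod>i = 0..<Suc m. D $$ (i, \<pi> i)) = (\<Prod>i<m. d i (\<pi> i)) * b m (\<pi> m)"
      using in_range by (simp add: D_def lessThan_atLeast0)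
    then show ?thesis
      using coeff_prod_linear(2)[of "\<lambda>i. b i (\<pi> i)" "\<lambda>i. d i (\<pi> i)" m]
      by (simp add: sign_def mult.commute)
  qed
  then have "coeff (det Z) m = det D"
    unfolding detZ det_def'[OF D] coeff_sum by (intro sum.cong) simp_all
  also have "det D = b m m"
    using det_corner[OF D] by (simp add: D_def d_def)
  finally have corner: "coeff (det Z) m = b m m" .
  have "poly (det Z) t = 0" for t
  proof -
    have "poly (det Z) t = det (mat (Suc m) (Suc m) (\<lambda>(i, j). b i j + t * d i j))"
      by (rule poly_det_cong[OF _ Z]) (auto simp: Z_def)
    then show ?thesis using zero[of t] by (simp add: d_def)
  qed
  then have roots: "{t. poly (det Z) t = 0} = UNIV" by simp
  \<comment> \<open>Every field element is a root, which is more than the degree bound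
    \<open>m\<close> allows for a nonzero polynomial.\<close>
  have "det Z = 0"
  proof (rule ccontr)
    assume "det Z \<noteq> 0"
    then show False
      using poly_roots_finite[of "det Z"] card_poly_roots_bound[of "det Z"] roots big deg by simp
  qed
  then show ?thesis using corner by simp
qed

text \<open>With \<open>E = 1 - A V U\<close>, the matrix \<open>U (B + t A) V\<close> is bordered
  by a row of \<open>E\<close> and the column \<open>v\<close>. Since \<open>E A = 0\<close> and
  \<open>U A v = 0\<close>, the part with \<open>t\<close> is the identity of size \<open>m\<close>
  with a zero corner, and the constant corner is an entry of \<open>E B v\<close>. The rank bound
  makes all these determinants vanish, so \<open>E B v = 0\<close>; and \<open>E B v = B v\<close>
  because \<open>U B v = 0\<close>.\<close>

lemma pencil_kernel:
  fixes A B :: "'a :: field mat"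
  assumes A: "A \<in> carrier_mat p q" and B: "B \<in> carrier_mat p q"
    and U: "U \<in> carrier_mat m p" and V: "V \<in> carrier_mat q m" and one: "U * A * V = 1\<^sub>m m"
    and rank: "\<And>t. vec_space.rank p (B + t \<cdot>\<^sub>m A) \<le> m" and rankA: "vec_space.rank p A \<le> m"
    and big: "infinite (UNIV :: 'a set) \<or> card (UNIV :: 'a set) > m"
    and v: "v \<in> carrier_vec q" and UAv: "(U * A) *\<^sub>v v = 0\<^sub>v m" and UBv: "(U * B) *\<^sub>v v = 0\<^sub>v m"
  shows "B *\<^sub>v v = 0\<^sub>v p"
proof -
  have no_minor: "det (W * M * Z) = 0"
    if "M \<in> carrier_mat p q" "vec_space.rank p M \<le> m" "W \<in> carrier_mat (Suc m) p" "Z \<in> carrier_mat q (Suc m)"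
    for M W Z :: "'a mat" using rank_ge_if_det[OF that(1,3,4)] that(2) by auto
  have AV: "A * V \<in> carrier_mat p m" and UA: "U * A \<in> carrier_mat m q" and AVU: "A * V * U \<in> carrier_mat p p"
    using A U V mult_carrier_mat by blast+
  have res: "A = A * V * (U * A)"
    using skeleton_decomposition[OF A U V one no_minor[OF A rankA]] .
  have Av: "A *\<^sub>v v = 0\<^sub>v p"
  proof -
    have "A *\<^sub>v v = (A * V) *\<^sub>v ((U * A) *\<^sub>v v)"
      by (subst res) (rule assoc_mult_mat_vec[OF AV UA v])
    also have "\<dots> = 0\<^sub>v p" unfolding UAv using AV by (intro eq_vecI) (auto simp: scalar_prod_def)
    finally show ?thesis .
  qed
  define E where "E = 1\<^sub>m p - A * V * U"
  have E: "E \<in> carrier_mat p p" unfolding E_def using AVU by (rule minus_carrier_mat)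
  have EA: "E * A = 0\<^sub>m p q"
  proof -
    have "E * A = A - A * V * U * A"
      unfolding E_def using A AVU by (subst minus_mult_distrib_mat[of _ p p]) auto
    also have "A * V * U * A = A" using assoc_mult_mat[OF AV U A] res by simp
    finally show ?thesis using A by simp
  qed
  \<comment> \<open>The vector \<open>v\<close> becomes a matrix with one column, so that it can
    serve as the bordering column in \<open>bordered_entry\<close>.\<close>
  define P where "P = mat q 1 (\<lambda>(i, j). v $ i)"
  have P: "P \<in> carrier_mat q 1" by (simp add: P_def)
  have lt1: "0 < (1::nat)" by simp
  have colP: "col P 0 = v" using v by (intro eq_vecI) (auto simp: P_def)
  have entryP: "(X * P) $$ (i, 0) = (X *\<^sub>v v) $ i" if "X \<in> carrier_mat a q" "i < a" for X i a
    using that P colP by simp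
  have EBv: "(E * B *\<^sub>v v) $ k = 0" if k: "k < p" for k
  proof -
    let ?W = "mat (Suc m) p (\<lambda>(i, j). if i < m then U $$ (i, j) else E $$ (k, j))"
    let ?Z = "mat q (Suc m) (\<lambda>(i, j). if j < m then V $$ (i, j) else P $$ (i, 0))"
    define b where "b i j = (?W * B * ?Z) $$ (i, j)" for i j
    have W: "?W \<in> carrier_mat (Suc m) p" and Z: "?Z \<in> carrier_mat q (Suc m)" by simp_all
    have WAZ: "(?W * A * ?Z) $$ (i, j) = (if i = j \<and> i < m then 1 else 0)"
      if i: "i < Suc m" and j: "j < Suc m" for i j
    proof -
      have "(0\<^sub>m p q * P) $$ (k, 0) = 0" "(0\<^sub>m p q * V) $$ (k, j) = 0" if "j < m"
        using that k V P by simp_all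
      moreover have "(0\<^sub>m p q * P) $$ (k, 0) = 0" using k P by simp
      moreover have "(U * A * P) $$ (i, 0) = 0" if "i < m"
        using entryP[OF UA that] UAv that by simp
      moreover have "(U * A * V) $$ (i, j) = (if i = j then 1 else 0)" if "i < m" "j < m"
        unfolding one using that by simp
      ultimately show ?thesis
        unfolding bordered_entry[OF A U E k V P lt1 i j]
        by (cases "i < m"; cases "j < m") (simp_all only: EA if_True if_False, auto)
    qed
    have "b m m = 0"
    proof (rule bordered_pencil_corner[OF big, where b = b])
      fix t
      have tA: "t \<cdot>\<^sub>m A \<in> carrier_mat p q" using A by simp
      have M: "B + t \<cdot>\<^sub>m A \<in> carrier_mat p q" using tA by simp
      have "mat (Suc m) (Suc m) (\<lambda>(i, j). b i j + t * (if i = j \<and> i < m then 1 else 0)) =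
          ?W * (B + t \<cdot>\<^sub>m A) * ?Z"
      proof (rule eq_matI)
        fix i j assume "i < dim_row (?W * (B + t \<cdot>\<^sub>m A) * ?Z)" "j < dim_col (?W * (B + t \<cdot>\<^sub>m A) * ?Z)"
        then have i: "i < Suc m" and j: "j < Suc m" by simp_all
        have "?W * (B + t \<cdot>\<^sub>m A) * ?Z = ?W * B * ?Z + ?W * (t \<cdot>\<^sub>m A) * ?Z"
          unfolding mult_add_distrib_mat[OF W B tA]
          by (rule add_mult_distrib_mat[OF mult_carrier_mat[OF W B] mult_carrier_mat[OF W tA] Z])
        also have "?W * (t \<cdot>\<^sub>m A) * ?Z = t \<cdot>\<^sub>m (?W * A * ?Z)"
          unfolding mult_smult_distrib[OF W A]
          by (rule mult_smult_assoc_mat[OF mult_carrier_mat[OF W A] Z])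
        finally have "(?W * (B + t \<cdot>\<^sub>m A) * ?Z) $$ (i, j) = b i j + t * (?W * A * ?Z) $$ (i, j)"
          unfolding b_def using i j by simp
        also have "\<dots> = b i j + t * (if i = j \<and> i < m then 1 else 0)"
          unfolding WAZ[OF i j] ..
        finally show "mat (Suc m) (Suc m) (\<lambda>(i, j). b i j + t * (if i = j \<and> i < m then 1 else 0)) $$ (i, j) =
          (?W * (B + t \<cdot>\<^sub>m A) * ?Z) $$ (i, j)" using i j by simp
      qed simp_all
      then show "det (mat (Suc m) (Suc m) (\<lambda>(i, j). b i j + t * (if i = j \<and> i < m then 1 else 0))) = 0"
        using no_minor[OF M rank W Z] by simp
    qed
    moreover have "b m m = (E * B * P) $$ (k, 0)"
      unfolding b_def bordered_entry[OF B U E k V P lt1 lessI lessI] by simp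
    moreover have "(E * B * P) $$ (k, 0) = (E * B *\<^sub>v v) $ k"
      by (rule entryP[OF mult_carrier_mat[OF E B] k])
    ultimately show ?thesis by simp
  qed
  have Bv: "B *\<^sub>v v \<in> carrier_vec p" using B v by simp
  have "E * B *\<^sub>v v = E *\<^sub>v (B *\<^sub>v v)" by (rule assoc_mult_mat_vec[OF E B v])
  also have "\<dots> = B *\<^sub>v v - (A * V * U) *\<^sub>v (B *\<^sub>v v)"
    unfolding E_def using minus_mult_distrib_mat_vec[of "1\<^sub>m p" p p "A * V * U" "B *\<^sub>v v"] AVU Bv by simp
  also have "(A * V * U) *\<^sub>v (B *\<^sub>v v) = (A * V) *\<^sub>v (U *\<^sub>v (B *\<^sub>v v))"
    by (rule assoc_mult_mat_vec[OF AV U Bv])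
  also have "U *\<^sub>v (B *\<^sub>v v) = 0\<^sub>v m" using assoc_mult_mat_vec[OF U B v] UBv by simp
  also have "(A * V) *\<^sub>v 0\<^sub>v m = 0\<^sub>v p" using AV by (intro eq_vecI) (auto simp: scalar_prod_def)
  also have "B *\<^sub>v v - 0\<^sub>v p = B *\<^sub>v v" using Bv by simp
  finally have "B *\<^sub>v v = E * B *\<^sub>v v" by simp
  then show ?thesis using EBv E B v by (intro eq_vecI) auto
qed

section \<open>Contractions of tensors\<close>

text \<open>The element of the span of the 1-slices of \<open>g\<close> with coefficients \<open>x\<close>.\<close>

definition contraction :: "nat \<Rightarrow> nat \<Rightarrow> nat \<Rightarrow> (nat \<Rightarrow> nat \<Rightarrow> nat \<Rightarrow> 'a :: field) \<Rightarrow> (nat \<Rightarrow> 'a) \<Rightarrow> 'a mat"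
  where "contraction r p q g x = mat p q (\<lambda>(b, c). \<Sum>a<r. x a * g a b c)"

lemma contraction_carrier [simp]: "contraction r p q g x \<in> carrier_mat p q"
  by (simp add: contraction_def)

lemma transpose_contraction:
  "(contraction r p q g x)\<^sup>T = contraction r q p (\<lambda>a c b. g a b c) x"
  by (intro eq_matI) (auto simp: contraction_def)

text \<open>Lets a rank bound for all contractions apply to every member of the pencil
  \<open>B + t A\<close>.\<close>

lemma contraction_add_smult:
  "contraction r p q g x + t \<cdot>\<^sub>m contraction r p q g y = contraction r p q g (\<lambda>a. x a + t * y a)"
  by (intro eq_matI)
    (auto simp: contraction_def sum.distrib sum_distrib_left algebra_simps)

text \<open>Both sides are the same sum over \<open>a\<close>, \<open>b\<close>, \<open>c\<close>,
  in different orders. Thus a vector killed by the contractions of the second mode along the rows of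
  \<open>U\<close> is killed by \<open>U * M\<close> for every contraction \<open>M\<close> of the
  first mode.\<close>

lemma contraction_swap:
  assumes U: "U \<in> carrier_mat m s" and v: "v \<in> carrier_vec n" and i: "i < m"
  shows "((U * contraction p s n f x) *\<^sub>v v) $ i =
    (\<Sum>a<p. x a * (contraction s p n (\<lambda>b a. f a b) (\<lambda>b. U $$ (i, b)) *\<^sub>v v) $ a)"
proof -
  let ?M = "contraction p s n f x"
  have "((U * ?M) *\<^sub>v v) $ i = (U *\<^sub>v (?M *\<^sub>v v)) $ i"
    using assoc_mult_mat_vec[OF U contraction_carrier v] by simp
  also have "\<dots> = (\<Sum>b<s. U $$ (i, b) * (\<Sum>c<n. (\<Sum>a<p. x a * f a b c) * v $ c))"
    using U v i by (simp add: contraction_def scalar_prod_def lessThan_atLeast0)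
  also have "\<dots> = (\<Sum>b<s. \<Sum>c<n. \<Sum>a<p. U $$ (i, b) * x a * f a b c * v $ c)"
    by (simp add: sum_distrib_left sum_distrib_right mult.assoc)
  also have "\<dots> = (\<Sum>b<s. \<Sum>a<p. \<Sum>c<n. U $$ (i, b) * x a * f a b c * v $ c)"
    by (intro sum.cong refl sum.swap)
  also have "\<dots> = (\<Sum>a<p. \<Sum>b<s. \<Sum>c<n. U $$ (i, b) * x a * f a b c * v $ c)"
    by (rule sum.swap)
  also have "\<dots> = (\<Sum>a<p. \<Sum>c<n. \<Sum>b<s. U $$ (i, b) * x a * f a b c * v $ c)"
    by (intro sum.cong refl sum.swap)
  also have "\<dots> = (\<Sum>a<p. x a * (\<Sum>c<n. (\<Sum>b<s. U $$ (i, b) * f a b c) * v $ c))"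
    by (simp add: sum_distrib_left sum_distrib_right mult_ac)
  also have "\<dots> = (\<Sum>a<p. x a * (contraction s p n (\<lambda>b a. f a b) (\<lambda>b. U $$ (i, b)) *\<^sub>v v) $ a)"
    using v by (intro sum.cong) (simp_all add: contraction_def scalar_prod_def lessThan_atLeast0)
  finally show ?thesis .
qed

text \<open>The modes \<open>i\<close>, \<open>j\<close>, \<open>k\<close> have dimensions
  \<open>p\<close>, \<open>s\<close>, \<open>n\<close> here, and \<open>r\<close>, \<open>q\<close>
  stand for the two values of \<open>Q\<close>. If \<open>r * q < n\<close>, a nonzero
  \<open>v\<close> solves the \<open>r * q\<close> equations \<open>R i v = 0\<close>; the pencil
  argument then shows that all contractions kill \<open>v\<close>, contradicting
  \<open>nondeg\<close>.\<close>

lemma dim_le_prod_contraction_ranks: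
  fixes f :: "nat \<Rightarrow> nat \<Rightarrow> nat \<Rightarrow> 'a :: field"
  assumes nondeg: "\<And>v. v \<in> carrier_vec n \<Longrightarrow> (\<And>a b. a < p \<Longrightarrow> b < s \<Longrightarrow> (\<Sum>c<n. f a b c * v $ c) = 0) \<Longrightarrow>
      v = 0\<^sub>v n"
    and rank_le: "\<And>x. vec_space.rank s (contraction p s n f x) \<le> r"
    and rank_eq: "vec_space.rank s (contraction p s n f x\<^sub>0) = r"
    and rank_le': "\<And>y. vec_space.rank p (contraction s p n (\<lambda>b a. f a b) y) \<le> q"
    and big: "infinite (UNIV :: 'a set) \<or> card (UNIV :: 'a set) > n"
  shows "n \<le> r * q"
proof (rule ccontr)
  assume "\<not> n \<le> r * q"
  then have less: "r * q < n" by simp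
  let ?A = "contraction p s n f x\<^sub>0"
  \<comment> \<open>The pencil argument asks for more than \<open>r\<close> field elements;
    \<open>?A\<close> has \<open>n\<close> columns, so the bound by \<open>n\<close>
    suffices.\<close>
  have "r \<le> n" using vec_space.rank_le_nc[OF contraction_carrier[of p s n f x\<^sub>0]] rank_eq by simp
  then have big_r: "infinite (UNIV :: 'a set) \<or> card (UNIV :: 'a set) > r" using big by auto
  obtain U V where U: "U \<in> carrier_mat r s" and V: "V \<in> carrier_mat n r" and one: "U * ?A * V = 1\<^sub>m r"
    using rank_attained[OF contraction_carrier[of p s n f x\<^sub>0]] unfolding rank_eq .
  define C where "C i = contraction s p n (\<lambda>b a. f a b) (\<lambda>b. U $$ (i, b))" for i
  have "\<exists>L R. L \<in> carrier_mat p q \<and> R \<in> carrier_mat q n \<and> C i = L * R" for i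
    unfolding C_def by (rule factor_of_rank_le[OF contraction_carrier rank_le']) blast
  then obtain L R where L: "\<And>i. L i \<in> carrier_mat p q" and R: "\<And>i. R i \<in> carrier_mat q n"
    and C: "\<And>i. C i = L i * R i" by metis
  \<comment> \<open>\<open>G\<close> stacks \<open>R 0, ..., R (r - 1)\<close>: its row
    \<open>i * q + j\<close> is row \<open>j\<close> of \<open>R i\<close>.\<close>
  define G where "G = mat (r * q) n (\<lambda>(l, c). R (l div q) $$ (l mod q, c))"
  have G: "G \<in> carrier_mat (r * q) n" by (simp add: G_def)
  obtain v where v: "v \<in> carrier_vec n" "v \<noteq> 0\<^sub>v n" "G *\<^sub>v v = 0\<^sub>v (r * q)"
    using wide_mat_kernel[OF G less] .
  have Rv: "R i *\<^sub>v v = 0\<^sub>v q" if i: "i < r" for i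
  proof (rule eq_vecI)
    fix j assume "j < dim_vec (0\<^sub>v q :: 'a vec)"
    then have j: "j < q" by simp
    have "i * q + j < Suc i * q" using j by simp
    also have "\<dots> \<le> r * q" using i by (intro mult_right_mono) auto
    finally have ij: "i * q + j < r * q" .
    have "row G (i * q + j) = row (R i) j"
      using ij j R[of i] by (intro eq_vecI) (auto simp: G_def)
    then have "(R i *\<^sub>v v) $ j = (G *\<^sub>v v) $ (i * q + j)" using ij j G R[of i] by simp
    then show "(R i *\<^sub>v v) $ j = 0\<^sub>v q $ j" unfolding v(3) using ij j by simp
  qed (use R[of i] in auto)
  have Cv: "C i *\<^sub>v v = 0\<^sub>v p" if i: "i < r" for i
  proof -
    have "C i *\<^sub>v v = L i *\<^sub>v (R i *\<^sub>v v)" unfolding C by (rule assoc_mult_mat_vec[OF L R v(1)])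
    also have "\<dots> = 0\<^sub>v p" unfolding Rv[OF i] using L[of i] by (intro eq_vecI) (auto simp: scalar_prod_def)
    finally show ?thesis .
  qed
  have UMv: "(U * contraction p s n f x) *\<^sub>v v = 0\<^sub>v r" for x
  proof (rule eq_vecI)
    fix i assume "i < dim_vec (0\<^sub>v r :: 'a vec)"
    then have i: "i < r" by simp
    show "((U * contraction p s n f x) *\<^sub>v v) $ i = 0\<^sub>v r $ i"
      unfolding contraction_swap[OF U v(1) i] C_def[symmetric] Cv[OF i] using i by simp
  qed (use U in auto)
  \<comment> \<open>\<open>UMv\<close> enters twice, for \<open>?A\<close> and for the contraction
    by \<open>x\<close>; the pencil of the two consists of contractions, so its ranks are at most
    \<open>r\<close>.\<close>
  have Mv: "contraction p s n f x *\<^sub>v v = 0\<^sub>v s" for x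
  proof (rule pencil_kernel[OF contraction_carrier contraction_carrier U V one _ _ big_r v(1) UMv UMv])
    show "vec_space.rank s (contraction p s n f x + t \<cdot>\<^sub>m ?A) \<le> r" for t
      unfolding contraction_add_smult by (rule rank_le)
  qed (rule rank_le)
  have "v = 0\<^sub>v n"
  proof (rule nondeg[OF v(1)])
    fix a b assume a: "a < p" and b: "b < s"
    \<comment> \<open>The indicator of \<open>a\<close> singles out one slice, whose product with
      \<open>v\<close> has the required sum as entry \<open>b\<close>.\<close>
    let ?e = "\<lambda>a'. if a' = a then 1 else 0 :: 'a"
    have "(\<Sum>c<n. f a b c * v $ c) = (contraction p s n f ?e *\<^sub>v v) $ b"
      using a b v(1)
      by (simp add: contraction_def scalar_prod_def lessThan_atLeast0 if_distrib [of "\<lambda>z. z * _"] cong: if_cong)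
    then show "(\<Sum>c<n. f a b c * v $ c) = 0" unfolding Mv using b by simp
  qed
  with v(2) show False by simp
qed

section \<open>Spans of slices, and ranks and conciseness under permutations of the modes\<close>

lemma slice_span_eq_contractions:
  fixes T :: "'a :: field tensor3"
  shows "slice_span n T l = range (contraction (n l) (slice_rows n l) (slice_cols n l) (coord T l))"
    (is "_ = range ?C")
proof -
  interpret M: matrix_vs "slice_rows n l" "slice_cols n l" "TYPE('a)" .
  have slices: "slice n T l ` {..<n l} \<subseteq> carrier_mat (slice_rows n l) (slice_cols n l)"
    by (auto simp: slice_def)
  \<comment> \<open>The contractions form a submodule containing the slices, hence they contain the
    span.\<close>
  have sub: "submodule class_ring (range ?C) M.V"
  proof
    fix v w assume "v \<in> range ?C" "w \<in> range ?C"
    then obtain x y where "v = ?C x" "w = ?C y" by blast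
    then have "v + w = ?C (\<lambda>a. x a + y a)"
      by (intro eq_matI) (auto simp: contraction_def sum.distrib distrib_right)
    then show "v \<oplus>\<^bsub>M.V\<^esub> w \<in> range ?C" by (auto simp: module_mat_simps)
  next
    have "?C (\<lambda>_. 0) = 0\<^sub>m (slice_rows n l) (slice_cols n l)"
      by (intro eq_matI) (auto simp: contraction_def)
    then show "\<zero>\<^bsub>M.V\<^esub> \<in> range ?C" by (auto simp: module_mat_simps intro: range_eqI[of _ _ "\<lambda>_. 0"])
  next
    fix c v assume "v \<in> range ?C"
    then obtain x where "v = ?C x" by blast
    then have "c \<cdot>\<^sub>m v = ?C (\<lambda>a. c * x a)"
      by (intro eq_matI) (auto simp: contraction_def sum_distrib_left mult.assoc)
    then show "c \<odot>\<^bsub>M.V\<^esub> v \<in> range ?C" by (auto simp: module_mat_simps)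
  qed (auto simp: module_mat_simps)
  have "slice n T l ` {..<n l} \<subseteq> range ?C"
  proof clarify
    fix a assume "a < n l"
    then have "slice n T l a = ?C (\<lambda>a'. if a' = a then 1 else 0)"
      by (intro eq_matI) (auto simp: slice_def contraction_def if_distrib [of "\<lambda>z. z * _"] cong: if_cong)
    then show "slice n T l a \<in> range ?C" by simp
  qed
  then have "slice_span n T l \<subseteq> range ?C"
    unfolding slice_span_def using M.span_is_subset sub by blast
  moreover have "?C x \<in> slice_span n T l" for x
  proof -
    \<comment> \<open>Conversely, a contraction is built up one slice at a time, by induction on the
      number \<open>k\<close> of slices used, and never leaves the span.\<close>
    have "contraction k (slice_rows n l) (slice_cols n l) (coord T l) x \<in> slice_span n T l" if "k \<le> n l" for k
      using that
    proof (induction k)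
      case 0
      have "contraction 0 (slice_rows n l) (slice_cols n l) (coord T l) x =
          0\<^sub>m (slice_rows n l) (slice_cols n l)"
        by (intro eq_matI) (auto simp: contraction_def)
      then show ?case unfolding slice_span_def
        using submodule.zero_closed[OF M.span_is_submodule[OF slices]] by (simp add: module_mat_simps)
    next
      case (Suc k)
      have "contraction (Suc k) (slice_rows n l) (slice_cols n l) (coord T l) x =
          contraction k (slice_rows n l) (slice_cols n l) (coord T l) x + x k \<cdot>\<^sub>m slice n T l k"
        by (intro eq_matI) (auto simp: contraction_def slice_def)
      moreover have "slice n T l k \<in> slice_span n T l"
        unfolding slice_span_def using M.in_own_span[OF slices] Suc.prems by auto
      ultimately show ?case
        using Suc submodule.m_closed[OF M.span_is_submodule[OF slices]]
          submodule.smult_closed[OF M.span_is_submodule[OF slices]]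
        by (simp add: module_mat_simps slice_span_def class_ring_simps)
    qed
    then show ?thesis by simp
  qed
  ultimately show ?thesis by blast
qed

text \<open>The tensor \<open>g\<close> is \<open>T\<close> with mode \<open>l\<close> moved to the front and the two remaining modes, of dimensions
  \<open>p\<close> and \<open>q\<close>, in either order.\<close>

definition arranges :: "(nat \<Rightarrow> nat) \<Rightarrow> 'a tensor3 \<Rightarrow> nat \<Rightarrow> nat \<Rightarrow> nat \<Rightarrow> 'a tensor3 \<Rightarrow> bool" where
  "arranges n T l p q g \<longleftrightarrow>
    g = coord T l \<and> p = slice_rows n l \<and> q = slice_cols n l \<or>
    g = (\<lambda>a y x. coord T l a x y) \<and> p = slice_cols n l \<and> q = slice_rows n l"

text \<open>Exchanging the two remaining modes transposes each contraction, which preserves the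
  rank.\<close>

lemma rank_arranged:
  assumes "arranges n T l p q g"
  shows "vec_space.rank p (contraction (n l) p q g x) =
    vec_space.rank (slice_rows n l) (contraction (n l) (slice_rows n l) (slice_cols n l) (coord T l) x)"
  using assms unfolding arranges_def
proof (elim disjE conjE)
  assume eqs: "g = (\<lambda>a y x. coord T l a x y)" "p = slice_cols n l" "q = slice_rows n l"
  show ?thesis
    unfolding eqs
    by (rule rank_transpose[OF contraction_carrier, unfolded transpose_contraction])
qed simp

lemma rank_arranged_le_Q:
  assumes "arranges n T l p q g"
  shows "vec_space.rank p (contraction (n l) p q g x) \<le> Q n T l"
  unfolding Q_def rank_arranged[OF assms]
  using finite_slice_span_ranks[of n l T] by (intro Max_ge) (auto simp: slice_span_eq_contractions)

lemma rank_arranged_eq_Q: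
  assumes "arranges n T l p q g"
  obtains x where "vec_space.rank p (contraction (n l) p q g x) = Q n T l"
proof -
  have "Q n T l \<in> vec_space.rank (slice_rows n l) ` slice_span n T l"
    unfolding Q_def using finite_slice_span_ranks[of n l T] slice_span_nonempty[of n T l]
    by (intro Max_in) auto
  then show thesis
    using that unfolding slice_span_eq_contractions rank_arranged[OF assms] by auto
qed

text \<open>The vanishing sums say that the transposed flattening kills \<open>v\<close>, and
  conciseness gives the flattening full row rank.\<close>

lemma concise_arranged:
  fixes T :: "'a :: field tensor3"
  assumes conc: "concise n T" and l: "l \<in> {1, 2, 3}" and arr: "arranges n T l p q g"
    and v: "v \<in> carrier_vec (n l)"
    and zero: "\<And>x y. x < p \<Longrightarrow> y < q \<Longrightarrow> (\<Sum>c<n l. g c x y * v $ c) = 0"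
  shows "v = 0\<^sub>v (n l)"
proof (rule full_row_rank_annihilator[OF _ _ v])
  let ?F = "flattening n T l"
  show F: "?F \<in> carrier_mat (n l) (slice_rows n l * slice_cols n l)" by (simp add: flattening_def)
  show "vec_space.rank (n l) ?F = n l" using conc l by (auto simp: concise_def)
  have zero': "(\<Sum>c<n l. coord T l c x y * v $ c) = 0" if "x < slice_rows n l" "y < slice_cols n l" for x y
    using arr zero that unfolding arranges_def by blast
  show "?F\<^sup>T *\<^sub>v v = 0\<^sub>v (slice_rows n l * slice_cols n l)"
  proof (rule eq_vecI)
    fix i assume "i < dim_vec (0\<^sub>v (slice_rows n l * slice_cols n l) :: 'a vec)"
    then have i: "i < slice_rows n l * slice_cols n l" by simp
    \<comment> \<open>A column index \<open>i\<close> exists, so the divisor is positive and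
      \<open>div\<close> and \<open>mod\<close> decode \<open>i\<close> into a pair of valid
      indices.\<close>
    have "slice_cols n l > 0" using i by (cases "slice_cols n l") auto
    then have "i div slice_cols n l < slice_rows n l" "i mod slice_cols n l < slice_cols n l"
      using i by (auto simp: less_mult_imp_div_less)
    from zero'[OF this] show "(?F\<^sup>T *\<^sub>v v) $ i = 0\<^sub>v (slice_rows n l * slice_cols n l) $ i"
      using i v by (simp add: flattening_def scalar_prod_def lessThan_atLeast0)
  qed (simp add: flattening_def)
qed

text \<open>\<open>f\<close> is \<open>T\<close> with its modes permuted into the order
  \<open>i\<close>, \<open>j\<close>, \<open>k\<close>.\<close>

lemma arrangement_exists:
  assumes "i \<in> {1, 2, 3}" and "j \<in> {1, 2, 3}" and "k \<in> {1, 2, 3}"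
    and "i \<noteq> j" and "j \<noteq> k" and "i \<noteq> k"
  obtains f where "arranges n T i (n j) (n k) f" "arranges n T j (n i) (n k) (\<lambda>b a. f a b)"
    "arranges n T k (n i) (n j) (\<lambda>c a b. f a b c)"
proof -
  have "(i, j, k) \<in> {(1, 2, 3), (1, 3, 2), (2, 1, 3), (2, 3, 1), (3, 1, 2), (3, 2, 1)}"
    using assms by auto
  then show thesis
    \<comment> \<open>The six candidates for \<open>f\<close> follow the order of the six triples
      above.\<close>
    using that[of "\<lambda>a b c. T a b c"] that[of "\<lambda>a b c. T a c b"] that[of "\<lambda>a b c. T b a c"]
      that[of "\<lambda>a b c. T c a b"] that[of "\<lambda>a b c. T b c a"] that[of "\<lambda>a b c. T c b a"]
    by (elim insertE emptyE) (simp_all add: arranges_def coord_def[abs_def] slice_rows_def slice_cols_def)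
qed

theorem theorem2p1:
  fixes n :: "nat \<Rightarrow> nat" and T :: "'a :: field tensor3" and i j k :: nat
  assumes "concise n T"
    and "i \<in> {1, 2, 3}" and "j \<in> {1, 2, 3}" and "k \<in> {1, 2, 3}"
    and "i \<noteq> j" and "j \<noteq> k" and "i \<noteq> k"
    and "infinite (UNIV :: 'a set) \<or> card (UNIV :: 'a set) > n k"
  shows "Q n T i * Q n T j \<ge> n k"
proof -
  obtain f where f: "arranges n T i (n j) (n k) f" "arranges n T j (n i) (n k) (\<lambda>b a. f a b)"
    "arranges n T k (n i) (n j) (\<lambda>c a b. f a b c)"
    using arrangement_exists[OF assms(2-7)] .
  \<comment> \<open>The coefficients \<open>x\<close> give a combination of \<open>i\<close>-slices
    of maximal rank, the matrix \<open>A\<close> of the pencil argument.\<close>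
  obtain x where x: "vec_space.rank (n j) (contraction (n i) (n j) (n k) f x) = Q n T i"
    using rank_arranged_eq_Q[OF f(1)] .
  show ?thesis
    using dim_le_prod_contraction_ranks[OF concise_arranged[OF assms(1,4) f(3)]
        rank_arranged_le_Q[OF f(1)] x rank_arranged_le_Q[OF f(2)] assms(8)] .
qed

end
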